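(* Let $a,b,c$ be nonnegative integers with $a+1\geqslant b$, $a+1\geqslant c$ and $b+1\geqslant c$. Put $A=a+2b+3c$, $\epsilon_{ij}=\max(0,i+j-b-c)$, and $m_{cj}\in\{0,1\}$ with $m_{cj}\equiv c-j \pmod 2$. Let \[\widetilde{Q}=\{(i,j)\in\mathbb{Z}^2 \mid 0\leqslant j\leqslant c,\ j\leqslant i\leqslant b+c,\ 2i+2j\leqslant a+b+2c-m_{cj}\}.\] Then \[F(a,b,c)=\sum_{(i,j)\in\widetilde{Q}}[\,i+\epsilon_{ij},\,A-2i-j\,]_{q,t},\] where for integers $k\leqslant \ell$ the symmetric chain is $[k,\ell]_{q,t}=q^{\ell}t^{k}+q^{\ell-1}t^{k+1}+\cdots+q^{k+1}t^{\ell-1}+q^{k}t^{\ell}$.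
   Context: Let $q,t$ be indeterminates. For $n\geqslant 1$, a standard Young tableau $T$ with $n$ boxes is a bijective filling of the Young diagram of a partition of $n$ by $1,\dots,n$, increasing along each row (left to right) and each column (bottom to top); rows $r=1,2,\dots$ are counted from the bottom and columns $c=1,2,\dots$ from the left. For $1\leqslant i\leqslant n$ let $z_i=z_i(T)=q^{c-1}t^{r-1}$ where $i$ sits in row $r$, column $c$ (so $z_1=1$). Define \[\mathrm{wt}(T)=\prod_{i=2}^{n}\frac{1}{(1-z_i^{-1})(1-qtz_{i-1}/z_i)}\prod_{1\leqslant i<j\leqslant n}\frac{(1-z_i/z_j)(1-qtz_i/z_j)}{(1-qz_i/z_j)(1-tz_i/z_j)},\] with the convention that any individual factor (in a numerator or a denominator) that vanishes is simply omitted. For integers $a_2,\dots,a_n$ set $F(a_2,\dots,a_n)=\sum_T z_2^{a_2}\cdots z_n^{a_n}\,\mathrm{wt}(T)$, the sum over all standard Young tableaux with $n$ boxes (a rational function of $q,t$). So $F(a,b,c)$ is the case $n=4$ with $(a_2,a_3,a_4)=(a,b,c)$. *)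

theory Defs
  imports
    Complex_Main
    "HOL-Library.FuncSet"
    "HOL-Computational_Algebra.Polynomial"
    "HOL-Computational_Algebra.Fraction_Field"
begin

text \<open>The field of rational functions \<open>\<rat>(q, t)\<close>, as the fraction field of \<open>\<rat>[t][q]\<close>.\<close>

type_synonym ratfun = "rat poly poly fract"

definition Q :: ratfun where
  "Q = Fract [:0, 1:] 1"

definition T :: ratfun where
  "T = Fract [:[:0, 1:]:] 1"

definition is_partition :: "nat \<Rightarrow> nat list \<Rightarrow> bool" where
  "is_partition n \<nu> \<longleftrightarrow> sorted_wrt (\<ge>) \<nu> \<and> 0 \<notin> set \<nu> \<and> sum_list \<nu> = n"

text \<open>A box is a pair (row, column), both counted from 1. Rows are counted from the bottom
  (French convention), so the bottom row is the longest one.\<close>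

definition young_diagram :: "nat list \<Rightarrow> (nat \<times> nat) set" where
  "young_diagram \<nu> = {(r, c). 1 \<le> r \<and> r \<le> length \<nu> \<and> 1 \<le> c \<and> c \<le> \<nu> ! (r - 1)}"

text \<open>A tableau is a pair of its shape and its filling. The filling is required to be
  \<^const>\<open>undefined\<close> outside the diagram, so that each tableau is represented exactly once.\<close>

definition standard_tableaux :: "nat \<Rightarrow> (nat list \<times> (nat \<times> nat \<Rightarrow> nat)) set" where
  "standard_tableaux n = {(\<nu>, f).
     is_partition n \<nu> \<and>
     f \<in> extensional (young_diagram \<nu>) \<and>
     bij_betw f (young_diagram \<nu>) {1..n} \<and>
     (\<forall>r c c'. (r, c) \<in> young_diagram \<nu> \<longrightarrow> (r, c') \<in> young_diagram \<nu> \<longrightarrow> c < c' \<longrightarrow>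
        f (r, c) < f (r, c')) \<and>
     (\<forall>r r' c. (r, c) \<in> young_diagram \<nu> \<longrightarrow> (r', c) \<in> young_diagram \<nu> \<longrightarrow> r < r' \<longrightarrow>
        f (r, c) < f (r', c))}"

definition box_of :: "nat list \<times> (nat \<times> nat \<Rightarrow> nat) \<Rightarrow> nat \<Rightarrow> nat \<times> nat" where
  "box_of S i = inv_into (young_diagram (fst S)) (snd S) i"

definition z :: "nat list \<times> (nat \<times> nat \<Rightarrow> nat) \<Rightarrow> nat \<Rightarrow> ratfun" where
  "z S i = (case box_of S i of (r, c) \<Rightarrow> Q ^ (c - 1) * T ^ (r - 1))"

text \<open>Implements the convention that vanishing factors are omitted; it is to be applied
  to each individual factor.\<close>

definition factor :: "ratfun \<Rightarrow> ratfun" where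
  "factor x = (if x = 0 then 1 else x)"

definition wt :: "nat \<Rightarrow> nat list \<times> (nat \<times> nat \<Rightarrow> nat) \<Rightarrow> ratfun" where
  "wt n S =
     (\<Prod>i = 2..n. 1 / (factor (1 - inverse (z S i)) * factor (1 - Q * T * z S (i - 1) / z S i))) *
     (\<Prod>(i, j) \<in> {(i, j). 1 \<le> i \<and> i < j \<and> j \<le> n}.
        (factor (1 - z S i / z S j) * factor (1 - Q * T * z S i / z S j)) /
        (factor (1 - Q * z S i / z S j) * factor (1 - T * z S i / z S j)))"

text \<open>The argument is the list \<open>[a\<^sub>2, \<dots>, a\<^sub>n]\<close>, so \<open>n\<close> is its length plus one
  and \<open>a\<^sub>i\<close> is its entry with (zero-based) position \<open>i - 2\<close>.\<close>

definition F :: "int list \<Rightarrow> ratfun" where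
  "F as = (let n = length as + 1 in
     \<Sum>S \<in> standard_tableaux n. (\<Prod>i = 2..n. z S i powi (as ! (i - 2))) * wt n S)"

text \<open>The symmetric chain; only meaningful for \<open>k \<le> l\<close>.\<close>

definition chain :: "int \<Rightarrow> int \<Rightarrow> ratfun" where
  "chain k l = (\<Sum>m = k..l. Q powi m * T powi (k + l - m))"

definition eps :: "int \<Rightarrow> int \<Rightarrow> int \<Rightarrow> int \<Rightarrow> int" where
  "eps b c i j = max 0 (i + j - b - c)"

definition Qtilde :: "int \<Rightarrow> int \<Rightarrow> int \<Rightarrow> (int \<times> int) set" where
  "Qtilde a b c = {(i, j). 0 \<le> j \<and> j \<le> c \<and> j \<le> i \<and> i \<le> b + c \<and>
     2 * i + 2 * j \<le> a + b + 2 * c - (c - j) mod 2}"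

end

theory Submission
  imports Defs
begin

text \<open>Grouping the ten tableaux by \<open>z\<^sub>2 \<in> {q, t}\<close> gives \<open>F(a, b, c) = q\<^sup>a S(q, t) + t\<^sup>a S(t, q)\<close>,
  where \<open>S\<close> is a combination of five exponentials in \<open>b\<close> and \<open>c\<close>. Hence \<open>F\<close> satisfies the
  recurrence with characteristic roots \<open>q\<close> and \<open>t\<close> in \<open>a\<close>. The sum of chains satisfies it as
  well: the points entering the summation region at \<open>a + 1\<close> and at \<open>a + 2\<close> can be matched, by
  \<open>(i, j) \<mapsto> (i + 1, j - 1)\<close> or \<open>(i, j) \<mapsto> (i, j + 1)\<close> depending on the parity of \<open>a + b\<close>, such that their
  contributions cancel. It remains to compare both sides for \<open>a = b - 1\<close> and \<open>a = b\<close>, where the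
  region is a triangle (plus some points on its hypotenuse) and the chain sum reduces to geometric
  series.\<close>

section \<open>Weights of the tableaux with four boxes\<close>

text \<open>Abstracts the two indeterminates. The property is symmetric, so each weight computed
  below can be reused with \<open>q\<close> and \<open>t\<close> exchanged.\<close>

definition monomial_indep :: "ratfun \<Rightarrow> ratfun \<Rightarrow> bool" where
  "monomial_indep q t \<longleftrightarrow> q \<noteq> 0 \<and> t \<noteq> 0 \<and>
     (\<forall>a b c d. q ^ a * t ^ b = q ^ c * t ^ d \<longrightarrow> a = c \<and> b = d)"

lemma indep_eq_iff:
  assumes "monomial_indep q t"
  shows "q ^ a * t ^ b = q ^ c * t ^ d \<longleftrightarrow> a = c \<and> b = d"
  using assms unfolding monomial_indep_def by blast

lemma indep_commute: "monomial_indep q t \<Longrightarrow> monomial_indep t q"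
  unfolding monomial_indep_def by (metis mult.commute)

definition pair_weight :: "ratfun \<Rightarrow> ratfun \<Rightarrow> ratfun \<Rightarrow> ratfun \<Rightarrow> ratfun" where
  "pair_weight q t x y =
     (factor (1 - x / y) * factor (1 - q * t * x / y)) /
     (factor (1 - q * x / y) * factor (1 - t * x / y))"

definition step_weight :: "ratfun \<Rightarrow> ratfun \<Rightarrow> ratfun \<Rightarrow> ratfun \<Rightarrow> ratfun" where
  "step_weight q t x y = 1 / (factor (1 - inverse y) * factor (1 - q * t * x / y))"

definition weight4 :: "ratfun \<Rightarrow> ratfun \<Rightarrow> ratfun \<Rightarrow> ratfun \<Rightarrow> ratfun \<Rightarrow> ratfun \<Rightarrow> ratfun" where
  "weight4 q t x1 x2 x3 x4 =
     step_weight q t x1 x2 * step_weight q t x2 x3 * step_weight q t x3 x4 *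
     (pair_weight q t x1 x2 * pair_weight q t x1 x3 * pair_weight q t x1 x4 *
      pair_weight q t x2 x3 * pair_weight q t x2 x4 * pair_weight q t x3 x4)"

text \<open>Kept opaque, so that equality of monomials is decided by comparing exponents.\<close>

definition mon :: "ratfun \<Rightarrow> ratfun \<Rightarrow> nat \<Rightarrow> nat \<Rightarrow> ratfun" where
  "mon q t a b = q ^ a * t ^ b"

lemma mon_commute: "mon t q a b = mon q t b a"
  by (simp add: mon_def)

lemma mon_nonzero: "monomial_indep q t \<Longrightarrow> mon q t a b \<noteq> 0"
  by (simp add: mon_def monomial_indep_def)

lemma mon_eq: "monomial_indep q t \<Longrightarrow> mon q t a b = mon q t c d \<longleftrightarrow> a = c \<and> b = d"
  by (simp add: mon_def indep_eq_iff)

text \<open>Monomials coincide only if their exponents do, so the convention on vanishing factors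
  becomes a test on exponents.\<close>

lemma factor_mon:
  assumes "monomial_indep q t"
  shows "factor (1 - mon q t a b / mon q t c d) =
    (if a = c \<and> b = d then 1 else (mon q t c d - mon q t a b) / mon q t c d)"
proof -
  have nz: "mon q t c d \<noteq> 0"
    by (rule mon_nonzero[OF assms])
  then have "1 - mon q t a b / mon q t c d = (mon q t c d - mon q t a b) / mon q t c d"
    by (simp add: diff_divide_distrib)
  moreover have "(mon q t c d - mon q t a b) / mon q t c d = 0 \<longleftrightarrow> a = c \<and> b = d"
    using nz mon_eq[OF assms, of c d a b] by auto
  ultimately show ?thesis
    using nz by (auto simp: factor_def)
qed

text \<open>Factors \<open>q\<close>, \<open>t\<close>, \<open>q * t\<close> are absorbed into the
  exponents, so that \<open>factor_mon\<close> applies throughout.\<close>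

lemma pair_weight_mon:
  "pair_weight q t (mon q t a b) (mon q t c d) =
    (factor (1 - mon q t a b / mon q t c d) * factor (1 - mon q t (Suc a) (Suc b) / mon q t c d)) /
     (factor (1 - mon q t (Suc a) b / mon q t c d) * factor (1 - mon q t a (Suc b) / mon q t c d))"
  by (simp add: pair_weight_def mon_def ac_simps)

lemma step_weight_mon:
  "step_weight q t (mon q t a b) (mon q t c d) =
    1 / (factor (1 - mon q t 0 0 / mon q t c d) *
         factor (1 - mon q t (Suc a) (Suc b) / mon q t c d))"
  by (simp add: step_weight_def mon_def ac_simps inverse_eq_divide)

lemma factor_0 [simp]: "factor 0 = 1"
  by (simp add: factor_def)

lemma indep_distinct:
  assumes "monomial_indep q t"
  shows "q \<noteq> 0" "t \<noteq> 0" "q \<noteq> t" "q\<^sup>2 \<noteq> t" "q ^ 3 \<noteq> t" "q\<^sup>2 \<noteq> t\<^sup>2" "q \<noteq> t\<^sup>2" "q \<noteq> t ^ 3"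
  using assms indep_eq_iff[OF assms, of 1 0 0 1] indep_eq_iff[OF assms, of 2 0 0 1]
    indep_eq_iff[OF assms, of 3 0 0 1] indep_eq_iff[OF assms, of 2 0 0 2]
    indep_eq_iff[OF assms, of 1 0 0 2] indep_eq_iff[OF assms, of 1 0 0 3]
  by (simp_all add: monomial_indep_def)

text \<open>The names of this lemma and the next four list the values of z at 2, 3, 4. These are the
  five tableaux whose entry 2 has value \<open>q\<close>.\<close>

lemma weight4_q_q2_q3:
  assumes i: "monomial_indep q t"
  shows "weight4 q t (mon q t 0 0) (mon q t 1 0) (mon q t 2 0) (mon q t 3 0) =
    q ^ 6 / ((q\<^sup>2 - t) * (q ^ 3 - t) * (q - t))"
  apply (simp add: weight4_def pair_weight_mon step_weight_mon factor_mon[OF i])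
  apply (simp add: mon_eq[OF i] mon_nonzero[OF i])
  \<comment> \<open>Denominators are cleared while \<open>mon\<close> is folded, where
    \<open>mon_eq\<close> shows differences of distinct monomials to be nonzero. Unfolding then
    leaves a polynomial identity.\<close>
  apply (simp add: divide_simps mon_eq[OF i] mon_nonzero[OF i] indep_distinct[OF i])
  apply (simp only: mon_def power_Suc power_0 mult_1_left mult_1_right)
  apply algebra
  done

lemma weight4_q_q2_t:
  assumes i: "monomial_indep q t"
  shows "weight4 q t (mon q t 0 0) (mon q t 1 0) (mon q t 2 0) (mon q t 0 1) =
    - (q ^ 3 * t) / ((q\<^sup>2 - t) * (q ^ 3 - t) * (q - t))"
  apply (simp add: weight4_def pair_weight_mon step_weight_mon factor_mon[OF i])
  apply (simp add: mon_eq[OF i] mon_nonzero[OF i])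
  apply (simp add: divide_simps mon_eq[OF i] mon_nonzero[OF i] indep_distinct[OF i])
  apply (simp only: mon_def power_Suc power_0 mult_1_left mult_1_right)
  apply algebra
  done

lemma weight4_q_t_q2:
  assumes i: "monomial_indep q t"
  shows "weight4 q t (mon q t 0 0) (mon q t 1 0) (mon q t 0 1) (mon q t 2 0) =
    - (q ^ 4 * t * (1 - t)) / ((q - t)\<^sup>2 * (q\<^sup>2 - t) * (q\<^sup>2 - t\<^sup>2))"
  apply (simp add: weight4_def pair_weight_mon step_weight_mon factor_mon[OF i])
  apply (simp add: mon_eq[OF i] mon_nonzero[OF i])
  apply (simp add: divide_simps mon_eq[OF i] mon_nonzero[OF i] indep_distinct[OF i])
  apply (simp only: mon_def power_Suc power_0 mult_1_left mult_1_right)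
  apply algebra
  done

lemma weight4_q_t_qt:
  assumes i: "monomial_indep q t"
  shows "weight4 q t (mon q t 0 0) (mon q t 1 0) (mon q t 0 1) (mon q t 1 1) =
    q\<^sup>2 * t\<^sup>2 * (1 - q) / ((q - t) ^ 3 * (q\<^sup>2 - t))"
  apply (simp add: weight4_def pair_weight_mon step_weight_mon factor_mon[OF i])
  apply (simp add: mon_eq[OF i] mon_nonzero[OF i])
  apply (simp add: divide_simps mon_eq[OF i] mon_nonzero[OF i] indep_distinct[OF i])
  apply (simp only: mon_def power_Suc power_0 mult_1_left mult_1_right)
  apply algebra
  done

lemma weight4_q_t_t2:
  assumes i: "monomial_indep q t"
  shows "weight4 q t (mon q t 0 0) (mon q t 1 0) (mon q t 0 1) (mon q t 0 2) =
    q * t ^ 3 / ((q - t)\<^sup>2 * (q\<^sup>2 - t\<^sup>2))"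
  apply (simp add: weight4_def pair_weight_mon step_weight_mon factor_mon[OF i])
  apply (simp add: mon_eq[OF i] mon_nonzero[OF i])
  apply (simp add: divide_simps mon_eq[OF i] mon_nonzero[OF i] indep_distinct[OF i])
  apply (simp only: mon_def power_Suc power_0 mult_1_left mult_1_right)
  apply algebra
  done

text \<open>Transposing a tableau exchanges \<open>q\<close> and \<open>t\<close>, so the five
  weights above yield the other five.\<close>

lemma weight4_commute: "weight4 t q x1 x2 x3 x4 = weight4 q t x1 x2 x3 x4"
  by (simp add: weight4_def step_weight_def pair_weight_def mult_ac)

section \<open>Enumeration of the tableaux\<close>

definition fill :: "nat \<times> nat \<Rightarrow> nat \<times> nat \<Rightarrow> nat \<times> nat \<Rightarrow> nat \<times> nat \<Rightarrow> nat \<times> nat \<Rightarrow> nat" where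
  "fill b1 b2 b3 b4 = (\<lambda>p. if p = b1 then 1 else if p = b2 then 2 else if p = b3 then 3
     else if p = b4 then 4 else undefined)"

text \<open>Each entry is a shape followed by the boxes holding 1, 2, 3, 4. As boxes are (row,
  column), \<open>(1,2)\<close> has value \<open>q\<close> and \<open>(2,1)\<close> has value
  \<open>t\<close>.\<close>

definition shapes_with_boxes ::
    "(nat list \<times> (nat \<times> nat) \<times> (nat \<times> nat) \<times> (nat \<times> nat) \<times> (nat \<times> nat)) set" where
  "shapes_with_boxes =
    {([4], (1,1), (1,2), (1,3), (1,4)),
     ([3,1], (1,1), (1,2), (1,3), (2,1)),
     ([3,1], (1,1), (1,2), (2,1), (1,3)),
     ([3,1], (1,1), (2,1), (1,2), (1,3)),
     ([2,2], (1,1), (1,2), (2,1), (2,2)),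
     ([2,2], (1,1), (2,1), (1,2), (2,2)),
     ([2,1,1], (1,1), (1,2), (2,1), (3,1)),
     ([2,1,1], (1,1), (2,1), (1,2), (3,1)),
     ([2,1,1], (1,1), (2,1), (3,1), (1,2)),
     ([1,1,1,1], (1,1), (2,1), (3,1), (4,1))}"

lemma young_diagram_Union: "young_diagram \<nu> = (\<Union>k<length \<nu>. {Suc k} \<times> {1..\<nu> ! k})"
proof -
  have "(r, c) \<in> (\<Union>k<length \<nu>. {Suc k} \<times> {1..\<nu> ! k})" if "(r, c) \<in> young_diagram \<nu>" for r c
    using that by (intro UN_I[of "r - 1"]) (auto simp: young_diagram_def)
  then show ?thesis
    by (auto simp: young_diagram_def)
qed

lemma young_diagrams_4:
  "young_diagram [4] = {(1,1), (1,2), (1,3), (1,4)}"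
  "young_diagram [3,1] = {(1,1), (1,2), (1,3), (2,1)}"
  "young_diagram [2,2] = {(1,1), (1,2), (2,1), (2,2)}"
  "young_diagram [2,1,1] = {(1,1), (1,2), (2,1), (3,1)}"
  "young_diagram [1,1,1,1] = {(1,1), (2,1), (3,1), (4,1)}"
  unfolding young_diagram_Union
  by (auto simp: numeral_eq_Suc lessThan_Suc atLeastAtMostSuc_conv)

lemma partitions_4:
  "is_partition 4 \<nu> \<longleftrightarrow> \<nu> \<in> {[4], [3,1], [2,2], [2,1,1], [1,1,1,1]}"
proof
  assume p: "is_partition 4 \<nu>"
  \<comment> \<open>Parts are positive, so there are at most as many as their sum; only lists of
    length up to 4 remain.\<close>
  have len: "length \<mu> \<le> sum_list \<mu>" if "0 \<notin> set \<mu>" for \<mu> :: "nat list"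
    using that by (induction \<mu>) auto
  have "length \<nu> \<le> 4"
    using len[of \<nu>] p by (auto simp: is_partition_def)
  then have "length \<nu> = 0 \<or> length \<nu> = 1 \<or> length \<nu> = 2 \<or> length \<nu> = 3 \<or> length \<nu> = 4"
    by arith
  then consider "\<nu> = []" | x where "\<nu> = [x]" | x y where "\<nu> = [x, y]"
    | x y w where "\<nu> = [x, y, w]" | x y w v where "\<nu> = [x, y, w, v]"
    by (auto simp: length_Suc_conv numeral_eq_Suc)
  then show "\<nu> \<in> {[4], [3,1], [2,2], [2,1,1], [1,1,1,1]}"
  proof cases
    case (3 x y)
    then have "x = 3 \<and> y = 1 \<or> x = 2 \<and> y = 2"
      using p by (simp add: is_partition_def) arith
    then show ?thesis using 3 by auto
  next
    case (4 x y w)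
    then have "x = 2 \<and> y = 1 \<and> w = 1"
      using p by (simp add: is_partition_def)
    then show ?thesis using 4 by auto
  next
    case (5 x y w v)
    then have "x = 1 \<and> y = 1 \<and> w = 1 \<and> v = 1"
      using p by (simp add: is_partition_def)
    then show ?thesis using 5 by auto
  qed (use p in \<open>auto simp: is_partition_def\<close>)
qed (auto simp: is_partition_def)

lemma shapes_with_boxes_diagram:
  assumes "(\<nu>, b1, b2, b3, b4) \<in> shapes_with_boxes"
  shows "young_diagram \<nu> = {b1, b2, b3, b4}" "distinct [b1, b2, b3, b4]"
proof -
  show "young_diagram \<nu> = {b1, b2, b3, b4}"
    using assms unfolding shapes_with_boxes_def
    by (elim insertE emptyE Pair_inject) (simp_all only: young_diagrams_4 insert_commute)
  show "distinct [b1, b2, b3, b4]"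
    using assms unfolding shapes_with_boxes_def
    by (elim insertE emptyE Pair_inject) simp_all
qed

lemma fill_simps:
  assumes "distinct [b1, b2, b3, b4]"
  shows "fill b1 b2 b3 b4 b1 = 1" "fill b1 b2 b3 b4 b2 = 2"
    "fill b1 b2 b3 b4 b3 = 3" "fill b1 b2 b3 b4 b4 = 4"
  using assms by (auto simp: fill_def)

lemma bij_betw_fill:
  assumes "distinct [b1, b2, b3, b4]"
  shows "bij_betw (fill b1 b2 b3 b4) {b1, b2, b3, b4} {1..4}"
proof (rule bij_betw_imageI)
  show "inj_on (fill b1 b2 b3 b4) {b1, b2, b3, b4}"
    using assms by (simp add: fill_simps[OF assms])
  have "{1..4} = {1, 2, 3, 4 :: nat}"
    by auto
  then show "fill b1 b2 b3 b4 ` {b1, b2, b3, b4} = {1..4}"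
    by (simp only: image_insert image_empty fill_simps[OF assms])
qed

lemma box_of_fill:
  assumes "(\<nu>, b1, b2, b3, b4) \<in> shapes_with_boxes"
  shows "box_of (\<nu>, fill b1 b2 b3 b4) 1 = b1" "box_of (\<nu>, fill b1 b2 b3 b4) 2 = b2"
    "box_of (\<nu>, fill b1 b2 b3 b4) 3 = b3" "box_of (\<nu>, fill b1 b2 b3 b4) 4 = b4"
proof -
  note D = shapes_with_boxes_diagram[OF assms]
  have inj: "inj_on (fill b1 b2 b3 b4) (young_diagram \<nu>)"
    using bij_betw_fill[OF D(2)] unfolding D(1) by (rule bij_betw_imp_inj_on)
  show "box_of (\<nu>, fill b1 b2 b3 b4) 1 = b1" "box_of (\<nu>, fill b1 b2 b3 b4) 2 = b2"
    "box_of (\<nu>, fill b1 b2 b3 b4) 3 = b3" "box_of (\<nu>, fill b1 b2 b3 b4) 4 = b4"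
    unfolding box_of_def fst_conv snd_conv
    by (rule inv_into_f_eq[OF inj]; simp add: D(1) fill_simps[OF D(2)])+
qed

text \<open>The preimages of 1 to 4 determine \<open>f\<close> on \<open>D\<close>, and
  extensionality determines it elsewhere.\<close>

lemma filling_eq_fill:
  assumes "bij_betw f D {1..4}" "f \<in> extensional D"
  obtains b1 b2 b3 b4 where "f = fill b1 b2 b3 b4" "D = {b1, b2, b3, b4}"
    "f b1 = 1" "f b2 = 2" "f b3 = 3" "f b4 = 4"
proof -
  define g where "g = inv_into D f"
  have g: "g i \<in> D" "f (g i) = i" if "i \<in> {1..4}" for i
    using assms that unfolding g_def bij_betw_def
    by (auto intro: inv_into_into f_inv_into_f simp del: atLeastAtMost_iff)
  have *: "{1..4} = {1, 2, 3, 4 :: nat}"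
    by auto
  have "bij_betw g {1..4} D"
    unfolding g_def using assms by (simp add: bij_betw_inv_into)
  then have D: "D = {g 1, g 2, g 3, g 4}"
    unfolding * by (auto simp: bij_betw_def)
  have "f = fill (g 1) (g 2) (g 3) (g 4)"
  proof
    fix p
    show "f p = fill (g 1) (g 2) (g 3) (g 4) p"
    proof (cases "p \<in> D")
      case True
      then show ?thesis
        using g(2)[of 1] g(2)[of 2] g(2)[of 3] g(2)[of 4] by (auto simp: D fill_def)
    next
      case False
      then show ?thesis
        using D extensional_arb[OF assms(2) False] by (auto simp: fill_def)
    qed
  qed
  then show thesis
    using D g by (intro that) auto
qed

lemma standard_tableaux_4:
  "standard_tableaux 4 =
     (\<lambda>(\<nu>, b1, b2, b3, b4). (\<nu>, fill b1 b2 b3 b4)) ` shapes_with_boxes"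
    (is "_ = ?h ` _")
proof (intro subset_antisym subsetI)
  fix S assume "S \<in> standard_tableaux 4"
  then obtain \<nu> f where S: "S = (\<nu>, f)" and p: "is_partition 4 \<nu>"
    and e: "f \<in> extensional (young_diagram \<nu>)" and b: "bij_betw f (young_diagram \<nu>) {1..4}"
    and row: "\<And>r c c'. (r, c) \<in> young_diagram \<nu> \<Longrightarrow> (r, c') \<in> young_diagram \<nu> \<Longrightarrow> c < c' \<Longrightarrow>
        f (r, c) < f (r, c')"
    and col: "\<And>r r' c. (r, c) \<in> young_diagram \<nu> \<Longrightarrow> (r', c) \<in> young_diagram \<nu> \<Longrightarrow> r < r' \<Longrightarrow>
        f (r, c) < f (r', c)"
    unfolding standard_tableaux_def by blast
  obtain b1 b2 b3 b4 where f: "f = fill b1 b2 b3 b4" and D: "young_diagram \<nu> = {b1, b2, b3, b4}"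
    and fb: "f b1 = 1" "f b2 = 2" "f b3 = 3" "f b4 = 4"
    using filling_eq_fill[OF b e] by metis
  have dist: "b1 \<noteq> b2" "b1 \<noteq> b3" "b1 \<noteq> b4" "b2 \<noteq> b3" "b2 \<noteq> b4" "b3 \<noteq> b4"
    using fb by auto
  have "b1 \<in> young_diagram \<nu>" "b2 \<in> young_diagram \<nu>" "b3 \<in> young_diagram \<nu>" "b4 \<in> young_diagram \<nu>"
    using D by auto
  note mem = this
  consider "\<nu> = [4]" | "\<nu> = [3,1]" | "\<nu> = [2,2]" | "\<nu> = [2,1,1]" | "\<nu> = [1,1,1,1]"
    using p unfolding partitions_4 by blast
  then have "(\<nu>, b1, b2, b3, b4) \<in> shapes_with_boxes"
  proof cases
    case 1
    have D1: "young_diagram \<nu> = {(1,1), (1,2), (1,3), (1,4)}"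
      unfolding 1 by (rule young_diagrams_4)
    \<comment> \<open>In each case comparing neighbouring boxes suffices: splitting
      \<open>mem\<close> lists all assignments of boxes to \<open>b1\<close>, ...,
      \<open>b4\<close>, and those that repeat a box or violate \<open>lt\<close> are
      refuted.\<close>
    have lt: "f (1, 1) < f (1, 2)" "f (1, 2) < f (1, 3)" "f (1, 3) < f (1, 4)"
      by (rule row col; simp add: D1)+
    show ?thesis
      using mem dist fb lt unfolding 1 young_diagrams_4 shapes_with_boxes_def
      by (elim insertE emptyE) simp_all
  next
    case 2
    have D1: "young_diagram \<nu> = {(1,1), (1,2), (1,3), (2,1)}"
      unfolding 2 by (rule young_diagrams_4)
    have lt: "f (1, 1) < f (1, 2)" "f (1, 1) < f (2, 1)" "f (1, 2) < f (1, 3)"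
      by (rule row col; simp add: D1)+
    show ?thesis
      using mem dist fb lt unfolding 2 young_diagrams_4 shapes_with_boxes_def
      by (elim insertE emptyE) simp_all
  next
    case 3
    have D1: "young_diagram \<nu> = {(1,1), (1,2), (2,1), (2,2)}"
      unfolding 3 by (rule young_diagrams_4)
    have lt: "f (1, 1) < f (1, 2)" "f (1, 1) < f (2, 1)" "f (1, 2) < f (2, 2)" "f (2, 1) < f (2, 2)"
      by (rule row col; simp add: D1)+
    show ?thesis
      using mem dist fb lt unfolding 3 young_diagrams_4 shapes_with_boxes_def
      by (elim insertE emptyE) simp_all
  next
    case 4
    have D1: "young_diagram \<nu> = {(1,1), (1,2), (2,1), (3,1)}"
      unfolding 4 by (rule young_diagrams_4)
    have lt: "f (1, 1) < f (1, 2)" "f (1, 1) < f (2, 1)" "f (2, 1) < f (3, 1)"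
      by (rule row col; simp add: D1)+
    show ?thesis
      using mem dist fb lt unfolding 4 young_diagrams_4 shapes_with_boxes_def
      by (elim insertE emptyE) simp_all
  next
    case 5
    have D1: "young_diagram \<nu> = {(1,1), (2,1), (3,1), (4,1)}"
      unfolding 5 by (rule young_diagrams_4)
    have lt: "f (1, 1) < f (2, 1)" "f (2, 1) < f (3, 1)" "f (3, 1) < f (4, 1)"
      by (rule row col; simp add: D1)+
    show ?thesis
      using mem dist fb lt unfolding 5 young_diagrams_4 shapes_with_boxes_def
      by (elim insertE emptyE) simp_all
  qed
  then show "S \<in> ?h ` shapes_with_boxes"
    unfolding S f by force
next
  fix S assume "S \<in> ?h ` shapes_with_boxes"
  then obtain \<nu> b1 b2 b3 b4 where S: "S = (\<nu>, fill b1 b2 b3 b4)"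
    and m: "(\<nu>, b1, b2, b3, b4) \<in> shapes_with_boxes"
    by auto
  note D = shapes_with_boxes_diagram[OF m]
  have "is_partition 4 \<nu>"
    using m by (auto simp: partitions_4 shapes_with_boxes_def)
  moreover have "fill b1 b2 b3 b4 \<in> extensional (young_diagram \<nu>)"
    unfolding D by (auto simp: fill_def extensional_def)
  moreover have "bij_betw (fill b1 b2 b3 b4) (young_diagram \<nu>) {1..4}"
    unfolding D(1) by (rule bij_betw_fill[OF D(2)])
  moreover have "fill b1 b2 b3 b4 (r, c) < fill b1 b2 b3 b4 (r, c')"
    if "(r, c) \<in> young_diagram \<nu>" "(r, c') \<in> young_diagram \<nu>" "c < c'" for r c c'
    using that m unfolding D(1) shapes_with_boxes_def
    by (elim insertE emptyE Pair_inject) (simp_all add: fill_def)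
  moreover have "fill b1 b2 b3 b4 (r, c) < fill b1 b2 b3 b4 (r', c)"
    if "(r, c) \<in> young_diagram \<nu>" "(r', c) \<in> young_diagram \<nu>" "r < r'" for r r' c
    using that m unfolding D(1) shapes_with_boxes_def
    by (elim insertE emptyE Pair_inject) (simp_all add: fill_def)
  ultimately show "S \<in> standard_tableaux 4"
    unfolding S standard_tableaux_def by blast
qed

section \<open>\<open>F\<close> as a sum over the ten tableaux\<close>

definition box_weight :: "ratfun \<Rightarrow> ratfun \<Rightarrow> nat \<times> nat \<Rightarrow> ratfun" where
  "box_weight q t b = mon q t (snd b - 1) (fst b - 1)"

lemma wt_4:
  "wt 4 S = weight4 Q T (z S 1) (z S 2) (z S 3) (z S 4)"
proof -
  have 1: "{2..4::nat} = {2, 3, 4}"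
    by auto
  have "{(i, j). 1 \<le> i \<and> i < j \<and> j \<le> (4::nat)} = {(1,2), (1,3), (1,4), (2,3), (2,4), (3,4)}"
    by auto
  then show ?thesis
    unfolding wt_def 1 weight4_def step_weight_def pair_weight_def by (simp add: ac_simps)
qed

definition tableau_term ::
    "int \<Rightarrow> int \<Rightarrow> int \<Rightarrow> nat \<times> nat \<Rightarrow> nat \<times> nat \<Rightarrow> nat \<times> nat \<Rightarrow> nat \<times> nat \<Rightarrow> ratfun" where
  "tableau_term a b c b1 b2 b3 b4 =
     box_weight Q T b2 powi a * box_weight Q T b3 powi b * box_weight Q T b4 powi c *
     weight4 Q T (box_weight Q T b1) (box_weight Q T b2) (box_weight Q T b3) (box_weight Q T b4)"

lemma F_4_sum:
  "F [a, b, c] = (\<Sum>(\<nu>, b1, b2, b3, b4) \<in> shapes_with_boxes. tableau_term a b c b1 b2 b3 b4)"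
proof -
  let ?h = "\<lambda>(\<nu>, b1, b2, b3, b4). (\<nu>, fill b1 b2 b3 b4)"
  \<comment> \<open>The boxes can be read back from a tableau with \<open>box_of\<close>.\<close>
  have inj: "inj_on ?h shapes_with_boxes"
    by (rule inj_on_inverseI[where g = "\<lambda>S. (fst S, box_of S 1, box_of S 2, box_of S 3, box_of S 4)"])
      (auto simp: box_of_fill simp del: One_nat_def)
  have 1: "{2..4::nat} = {2, 3, 4}"
    by auto
  have len: "length [a, b, c] + 1 = 4"
    by simp
  have "F [a, b, c] = (\<Sum>S \<in> standard_tableaux 4. z S 2 powi a * z S 3 powi b * z S 4 powi c *
      weight4 Q T (z S 1) (z S 2) (z S 3) (z S 4))"
    unfolding F_def Let_def len by (simp only: 1 wt_4) (simp add: ac_simps)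
  also have "\<dots> = (\<Sum>(\<nu>, b1, b2, b3, b4) \<in> shapes_with_boxes. tableau_term a b c b1 b2 b3 b4)"
    unfolding standard_tableaux_4 sum.reindex[OF inj]
    by (intro sum.cong refl)
      (auto simp: tableau_term_def z_def box_of_fill box_weight_def mon_def split: prod.splits
        simp del: One_nat_def)
  finally show ?thesis .
qed

text \<open>Products of powers are monomials of the polynomial ring, and distinct monomials stay
  distinct in its fraction field.\<close>

lemma indep_QT: "monomial_indep Q T"
proof -
  have Q: "Q ^ a * T ^ b = Fract (monom (monom 1 b) a) 1" for a b
  proof -
    have "Q ^ a = Fract ([:0, 1:] ^ a) 1" "T ^ b = Fract ([:[:0, 1:]:] ^ b) 1"
      by (induction a, simp_all add: Q_def One_fract_def)
        (induction b, simp_all add: T_def One_fract_def)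
    moreover have "[:0, 1:] ^ a = (monom 1 a :: rat poly poly)"
      by (simp add: monom_altdef)
    moreover have "[:[:0, 1:]:] ^ b = [:monom 1 b :: rat poly:]"
      by (simp add: monom_altdef poly_const_pow)
    ultimately show ?thesis
      by (simp add: mult_monom smult_monom)
  qed
  have "Q \<noteq> 0" "T \<noteq> 0"
    by (simp_all add: Q_def T_def Zero_fract_def eq_fract)
  then show ?thesis
    unfolding monomial_indep_def Q by (auto simp: eq_fract monom_eq_iff')
qed

section \<open>Geometric series\<close>

lemma power_int_numeral_mult: "x powi (numeral n * k) = (x powi k) ^ numeral n"
  for x :: "'a :: field"
  by (metis mult.commute power_int_mult power_int_numeral)

text \<open>Unlike \<^const>\<open>chain\<close>, this is given by the same formula for all \<open>k\<close> and \<open>l\<close>; the two agree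
  for \<open>k \<le> l + 1\<close>.\<close>

definition closed_chain :: "'a \<Rightarrow> 'a \<Rightarrow> int \<Rightarrow> int \<Rightarrow> 'a :: field" where
  "closed_chain q t k l = (q powi (l + 1) * t powi k - q powi k * t powi (l + 1)) / (q - t)"

lemma closed_chain_empty [simp]: "closed_chain q t k (k - 1) = 0"
  by (simp add: closed_chain_def)

lemma closed_chain_shift:
  assumes "q \<noteq> 0" "t \<noteq> 0"
  shows "closed_chain q t (k + 1) (l + 1) = q * t * closed_chain q t k l"
\<comment> \<open>For \<open>q = t\<close> both sides are 0, because division by 0 yields 0.\<close>
proof (cases "q = t")
  case False
  show ?thesis
    by (simp add: False assms closed_chain_def power_int_add divide_simps) algebra
qed (simp add: closed_chain_def)

text \<open>For fixed \<open>k\<close> the closed chain is a combination of \<open>q powi l\<close>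
  and \<open>t powi l\<close>.\<close>

lemma closed_chain_recurrence:
  assumes "q \<noteq> 0" "t \<noteq> 0"
  shows "closed_chain q t k (l + 2) - (q + t) * closed_chain q t k (l + 1)
    = - (q * t * closed_chain q t k l)"
proof (cases "q = t")
  case False
  show ?thesis
    by (simp add: False assms closed_chain_def power_int_add divide_simps) algebra
qed (simp add: closed_chain_def)

lemma closed_chain_commute: "closed_chain t q k l = closed_chain q t k l"
  unfolding closed_chain_def by (metis minus_diff_eq minus_divide_divide mult.commute)

lemma sum_chain_closed:
  fixes q t :: "'a :: field"
  assumes "q \<noteq> 0" "t \<noteq> 0" "q \<noteq> t" "k \<le> l + 1"
  shows "(\<Sum>m = k..l. q powi m * t powi (k + l - m)) = closed_chain q t k l"
proof -
  \<comment> \<open>A free \<open>n\<close> in place of \<open>k + l\<close> keeps the total degree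
    fixed while \<open>l\<close> varies in the induction.\<close>
  have "(\<Sum>m = k..l. q powi m * t powi (n - m)) =
      (q powi (l + 1) * t powi (n - l) - q powi k * t powi (n + 1 - k)) / (q - t)" for n
    using assms(4)
  proof (induction "l + 1" arbitrary: l rule: int_ge_induct)
    case base
    then have "{k..l} = {}" "l + 1 = k" "n - l = n + 1 - k"
      by simp_all
    then show ?case
      by (simp only:) simp
  next
    case (step i)
    have "{k..l} = insert l {k..l - 1}"
      using step by auto
    then have "(\<Sum>m = k..l. q powi m * t powi (n - m)) = q powi l * t powi (n - l) +
        (q powi l * t powi (n - (l - 1)) - q powi k * t powi (n + 1 - k)) / (q - t)"
      using step(2)[of "l - 1"] step by simp
    also have "\<dots> = (q powi (l + 1) * t powi (n - l) - q powi k * t powi (n + 1 - k)) / (q - t)"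
      by (simp add: assms power_int_add power_int_diff divide_simps) algebra
    finally show ?case .
  qed
  from this[of "k + l"] show ?thesis
    by (simp add: closed_chain_def algebra_simps)
qed

text \<open>A geometric series with ratio \<open>t / q^2\<close>. At \<open>j = m + 1\<close> its
  closed form is minus the summand at \<open>m\<close>, whereas the sum over the empty interval is
  0; the subtracted term repairs this.\<close>

lemma geometric_column:
  fixes q t :: "'a :: field"
  assumes "q \<noteq> 0" "t \<noteq> 0" "q\<^sup>2 \<noteq> t" "j \<le> m + 1"
  shows "(\<Sum>i = j..m - 1. q powi (K - 2 * i) * t powi i) -
      (if j = m + 1 then q powi (K - 2 * m) * t powi m else 0) =
    q\<^sup>2 * (q powi (K - 2 * j) * t powi j - q powi (K - 2 * m) * t powi m) / (q\<^sup>2 - t)"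
    (is "_ = ?C m")
proof (cases "j = m + 1")
  case True
  show ?thesis
    by (simp add: True assms power_int_add power_int_diff power_int_numeral_mult distrib_left divide_simps) algebra
next
  case False
  then have "j \<le> m"
    using assms by simp
  then have "(\<Sum>i = j..m - 1. q powi (K - 2 * i) * t powi i) = ?C m"
  proof (induction m rule: int_ge_induct)
    case (step m)
    have "{j..m} = insert m {j..m - 1}"
      using step by auto
    then have "(\<Sum>i = j..m. q powi (K - 2 * i) * t powi i) = q powi (K - 2 * m) * t powi m + ?C m"
      using step by simp
    also have "\<dots> = ?C (m + 1)"
      by (simp add: assms power_int_add power_int_diff power_int_numeral_mult distrib_left divide_simps) algebra
    finally show ?case
      by simp
  qed simp
  then show ?thesis
    using False by simp
qed

text \<open>The right-hand side of \<open>geometric_column\<close> for \<open>K = 3 * N - j\<close>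
  and \<open>m = N - j\<close>. It belongs to column \<open>j\<close> of the triangle
  \<open>j <= i\<close>, \<open>i + j <= N - 1\<close>.\<close>

definition column :: "'a \<Rightarrow> 'a \<Rightarrow> int \<Rightarrow> int \<Rightarrow> 'a :: field" where
  "column q t N j = q\<^sup>2 * (q powi (3 * N - 3 * j) * t powi j - q powi (N + j) * t powi (N - j)) / (q\<^sup>2 - t)"

text \<open>Used for the two terms of \<open>column\<close>: once with \<open>d = 3\<close>, once
  with \<open>d = 1\<close> and \<open>q\<close>, \<open>t\<close> exchanged.\<close>

lemma sum_geometric_powi:
  fixes q t :: "'a :: field"
  assumes "q \<noteq> 0" "t \<noteq> 0" "q ^ d \<noteq> t" "c \<ge> -1"
  shows "(\<Sum>j = 0..c. q powi (M - int d * j) * t powi j) =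
    (q powi (M + int d) - q powi (M - int d * c) * t powi (c + 1)) / (q ^ d - t)"
    (is "_ = ?C c")
  using \<open>c \<ge> -1\<close>
proof (induction c rule: int_ge_induct)
  case base
  then show ?case
    by simp
next
  case (step c)
  have "{0..c + 1} = insert (c + 1) {0..c}"
    using step by auto
  then have "(\<Sum>j = 0..c + 1. q powi (M - int d * j) * t powi j) =
      q powi (M - int d * (c + 1)) * t powi (c + 1) + ?C c"
    using step by simp
  also have "\<dots> = ?C (c + 1)"
    by (simp add: assms(1-3) power_int_add power_int_diff distrib_left divide_simps) algebra
  finally show ?case .
qed

lemma sum_column:
  fixes q t :: "'a :: field"
  assumes "q \<noteq> 0" "t \<noteq> 0" "q \<noteq> t" "q\<^sup>2 \<noteq> t" "q ^ 3 \<noteq> t" "c \<ge> -1"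
  shows "(\<Sum>j = 0..c. column q t N j) =
    q\<^sup>2 / (q\<^sup>2 - t) *
     ((q powi (3 * N + 3) - q powi (3 * N - 3 * c) * t powi (c + 1)) / (q ^ 3 - t) -
      (q powi (N + c + 1) * t powi (N - c) - q powi N * t powi (N + 1)) / (q - t))"
proof -
  have 1: "(\<Sum>j = 0..c. q powi (3 * N - 3 * j) * t powi j) =
      (q powi (3 * N + 3) - q powi (3 * N - 3 * c) * t powi (c + 1)) / (q ^ 3 - t)"
    using sum_geometric_powi[OF assms(1,2,5,6), of "3 * N"] by simp
  have "(\<Sum>j = 0..c. q powi (N + j) * t powi (N - j)) =
      (\<Sum>j = 0..c. t powi (N - j) * q powi j) * q powi N"
    unfolding sum_distrib_right by (simp add: assms(1) power_int_add mult_ac)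
  also have "\<dots> =
      (t powi (N + 1) - t powi (N - c) * q powi (c + 1)) / (t - q) * q powi N"
    using sum_geometric_powi[of t q 1 c N] assms(1-3,6)
    by simp
  also have "\<dots> = (q powi (N + c + 1) * t powi (N - c) - q powi N * t powi (N + 1)) / (q - t)"
    by (simp add: assms(1-3) assms(3)[symmetric] power_int_add divide_simps) algebra
  finally have 2: "(\<Sum>j = 0..c. q powi (N + j) * t powi (N - j)) = \<dots>" .
  show ?thesis
    unfolding column_def 1[symmetric] 2[symmetric] sum_subtractf[symmetric] sum_distrib_left
    by simp
qed

text \<open>For \<open>N = b + c\<close> these chains belong to the line \<open>i + j = N\<close>,
  reached at \<open>a = b\<close>, where the parity term admits only even \<open>c - j\<close>. If
  \<open>b = c - 1\<close>, the term \<open>j = c\<close> lies outside the region.\<close>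

definition even_chains :: "'a \<Rightarrow> 'a \<Rightarrow> int \<Rightarrow> int \<Rightarrow> 'a :: field" where
  "even_chains q t N c =
    (\<Sum>j \<in> {j. 0 \<le> j \<and> j \<le> c \<and> even (c - j)}. closed_chain q t (N - j) (N + j))"

lemma even_chains_closed:
  fixes q t :: "'a :: field"
  assumes "q \<noteq> 0" "t \<noteq> 0" "q \<noteq> t" "q\<^sup>2 \<noteq> t\<^sup>2" "c \<ge> -2"
  shows "even_chains q t N c =
    (q powi (N + c + 3) * t powi (N - c) + q powi (N - c) * t powi (N + c + 3)) /
      ((q - t) * (q\<^sup>2 - t\<^sup>2)) - q powi (N + 1) * t powi (N + 1) / (q - t)\<^sup>2"
    (is "_ = ?C c")
proof -
  have empty: "{j. 0 \<le> j \<and> j \<le> d \<and> P j} = {}" if "d < 0" for d :: int and P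
    using that by auto
  \<comment> \<open>Steps of two preserve the parity of \<open>c\<close>; they start from -2 and -1,
    where the sum is empty.\<close>
  have "even_chains q t N (int n - 2) = ?C (int n - 2)" for n
  proof (induction n rule: induct_nat_012)
    case 0
    show ?case
      by (simp add: assms(1-4) even_chains_def empty power_int_add power_int_diff divide_simps) algebra
  next
    case 1
    show ?case
      by (simp add: assms(1-4) even_chains_def empty power_int_add power_int_diff divide_simps) algebra
  next
    case (ge2 n)
    define c where "c = int n - 2"
    have c: "int (Suc (Suc n)) - 2 = c + 2" "c \<ge> -2"
      by (simp_all add: c_def)
    have "{j. 0 \<le> j \<and> j \<le> c + 2 \<and> even (c + 2 - j)} =
        insert (c + 2) {j. 0 \<le> j \<and> j \<le> c \<and> even (c - j)}" (is "?A = insert _ ?B")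
    proof -
      have "0 \<le> j \<and> j \<le> c + 2 \<and> even (c + 2 - j) \<longleftrightarrow>
          j = c + 2 \<or> 0 \<le> j \<and> j \<le> c \<and> even (c - j)" for j
        using c(2) by presburger
      then show ?thesis
        by blast
    qed
    moreover have "finite ?B"
      by (rule finite_subset[of _ "{0..c}"]) auto
    ultimately have "even_chains q t N (c + 2) =
        closed_chain q t (N - (c + 2)) (N + (c + 2)) + even_chains q t N c"
      by (simp add: even_chains_def)
    also have "\<dots> = closed_chain q t (N - (c + 2)) (N + (c + 2)) + ?C c"
      using ge2 by (simp add: c_def)
    also have "\<dots> = ?C (c + 2)"
    proof -
      \<comment> \<open>Apart from a constant term, everything is linear in \<open>X\<close> and
        \<open>Y\<close>, so \<open>coeffs\<close> only has to compare coefficients.\<close>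
      define X Y where "X = q powi (N + c) * t powi (N - c)" and "Y = q powi (N - c) * t powi (N + c)"
      have coeffs: "q ^ 5 / t\<^sup>2 / ((q - t) * (q\<^sup>2 - t\<^sup>2)) =
          q ^ 3 / t\<^sup>2 / (q - t) + q ^ 3 / ((q - t) * (q\<^sup>2 - t\<^sup>2))"
        "t ^ 5 / q\<^sup>2 / ((q - t) * (q\<^sup>2 - t\<^sup>2)) =
          t ^ 3 / ((q - t) * (q\<^sup>2 - t\<^sup>2)) - t ^ 3 / q\<^sup>2 / (q - t)"
        by (simp add: assms(1-4) divide_simps; algebra)+
      have "?C c = q ^ 3 / ((q - t) * (q\<^sup>2 - t\<^sup>2)) * X + t ^ 3 / ((q - t) * (q\<^sup>2 - t\<^sup>2)) * Y -
          q powi (N + 1) * t powi (N + 1) / (q - t)\<^sup>2"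
        by (simp add: X_def Y_def assms(1,2) power_int_add add_divide_distrib mult_ac)
      moreover have "?C (c + 2) = q ^ 5 / t\<^sup>2 / ((q - t) * (q\<^sup>2 - t\<^sup>2)) * X +
          t ^ 5 / q\<^sup>2 / ((q - t) * (q\<^sup>2 - t\<^sup>2)) * Y - q powi (N + 1) * t powi (N + 1) / (q - t)\<^sup>2"
        by (simp add: X_def Y_def assms(1,2) power_int_add power_int_diff diff_diff_eq[symmetric]
            add_divide_distrib power_numeral_reduce mult_ac)
      moreover have "closed_chain q t (N - (c + 2)) (N + (c + 2)) =
          q ^ 3 / t\<^sup>2 / (q - t) * X - t ^ 3 / q\<^sup>2 / (q - t) * Y"
        by (simp add: X_def Y_def closed_chain_def assms(1,2) power_int_add power_int_diff
            diff_diff_eq[symmetric] diff_divide_distrib power_numeral_reduce mult_ac)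
      ultimately show ?thesis
        unfolding coeffs by (simp only:) (simp add: algebra_simps)
    qed
    finally show ?case
      unfolding c .
  qed
  from this[of "nat (c + 2)"] show ?thesis
    using assms(5) by simp
qed

section \<open>Closed forms of the two halves of \<open>F\<close>\<close>

text \<open>The part of \<open>F [a, b, c]\<close> coming from the tableaux with \<open>z\<^sub>2 = q\<close>, divided by \<open>q\<^sup>a\<close>.\<close>

definition half_sum :: "'a \<Rightarrow> 'a \<Rightarrow> int \<Rightarrow> int \<Rightarrow> 'a :: field" where
  "half_sum q t b c =
     (q\<^sup>2) powi b * (q ^ 3) powi c * (q ^ 6 / ((q\<^sup>2 - t) * (q ^ 3 - t) * (q - t))) +
     (q\<^sup>2) powi b * t powi c * (- (q ^ 3 * t) / ((q\<^sup>2 - t) * (q ^ 3 - t) * (q - t))) +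
     t powi b * (q\<^sup>2) powi c *
       (- (q ^ 4 * t * (1 - t)) / ((q - t)\<^sup>2 * (q\<^sup>2 - t) * (q\<^sup>2 - t\<^sup>2))) +
     t powi b * (q * t) powi c * (q\<^sup>2 * t\<^sup>2 * (1 - q) / ((q - t) ^ 3 * (q\<^sup>2 - t))) +
     t powi b * (t\<^sup>2) powi c * (q * t ^ 3 / ((q - t)\<^sup>2 * (q\<^sup>2 - t\<^sup>2)))"

text \<open>Both sides are combinations of the same five exponentials in \<open>b\<close> and
  \<open>c\<close>, so coefficients are compared.\<close>

lemma half_sum_eq:
  fixes q t :: "'a :: field"
  assumes "q \<noteq> 0" "t \<noteq> 0" "q \<noteq> t" "q\<^sup>2 \<noteq> t" "q ^ 3 \<noteq> t" "q\<^sup>2 \<noteq> t\<^sup>2" "c \<ge> 0"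
  shows "(q - t) * (q powi (b - 1) * half_sum q t b c) =
    (\<Sum>j = 0..c. column q t (b + c) j) + even_chains q t (b + c) c"
proof -
  have pw: "(x ^ n) powi k = (x powi k) ^ n" for x :: 'a and n k
    by (simp flip: power_int_mult power_int_of_nat add: mult.commute)
  have c: "c \<ge> -1" "c \<ge> -2"
    using assms by auto
  define C1 C2 C3 C4 C5 where
    "C1 = q ^ 6 / ((q\<^sup>2 - t) * (q ^ 3 - t) * (q - t))" and
    "C2 = - (q ^ 3 * t) / ((q\<^sup>2 - t) * (q ^ 3 - t) * (q - t))" and
    "C3 = - (q ^ 4 * t * (1 - t)) / ((q - t)\<^sup>2 * (q\<^sup>2 - t) * (q\<^sup>2 - t\<^sup>2))" and
    "C4 = q\<^sup>2 * t\<^sup>2 * (1 - q) / ((q - t) ^ 3 * (q\<^sup>2 - t))" and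
    "C5 = q * t ^ 3 / ((q - t)\<^sup>2 * (q\<^sup>2 - t\<^sup>2))"
  \<comment> \<open>Each rescaled weight splits into a contribution of \<open>column\<close> and one
    of \<open>even_chains\<close>; \<open>C1\<close> and \<open>C2\<close> have only the former,
    \<open>C5\<close> only the latter.\<close>
  have C: "(q - t) * C1 / q = q\<^sup>2 / (q\<^sup>2 - t) * q ^ 3 / (q ^ 3 - t)"
    "(q - t) * C2 / q = - (q\<^sup>2 / (q\<^sup>2 - t) * t / (q ^ 3 - t))"
    "(q - t) * C3 / q = q ^ 3 / ((q - t) * (q\<^sup>2 - t\<^sup>2)) - q\<^sup>2 / (q\<^sup>2 - t) * q / (q - t)"
    "(q - t) * C4 / q = q\<^sup>2 / (q\<^sup>2 - t) * t / (q - t) - q * t / (q - t)\<^sup>2"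
    "(q - t) * C5 / q = t ^ 3 / ((q - t) * (q\<^sup>2 - t\<^sup>2))"
    unfolding C1_def C2_def C3_def C4_def C5_def
    by (simp add: assms(1-6) divide_simps; algebra)+
  define P R U V where "P = q powi b" and "R = q powi c" and "U = t powi b" and "V = t powi c"
  have "half_sum q t b c = P\<^sup>2 * R ^ 3 * C1 + P\<^sup>2 * V * C2 + U * R\<^sup>2 * C3 + U * (R * V) * C4 + U * V\<^sup>2 * C5"
    unfolding half_sum_def pw power_int_mult_distrib
    unfolding P_def[symmetric] R_def[symmetric] U_def[symmetric] V_def[symmetric]
      C1_def C2_def C3_def C4_def C5_def ..
  then have "(q - t) * (q powi (b - 1) * half_sum q t b c) =
      P * (P\<^sup>2 * R ^ 3 * ((q - t) * C1 / q) + P\<^sup>2 * V * ((q - t) * C2 / q) +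
        U * R\<^sup>2 * ((q - t) * C3 / q) + U * (R * V) * ((q - t) * C4 / q) + U * V\<^sup>2 * ((q - t) * C5 / q))"
    by (simp add: P_def power_int_diff assms(1) algebra_simps add_divide_distrib diff_divide_distrib)
  moreover have "(\<Sum>j = 0..c. column q t (b + c) j) =
    q\<^sup>2 / (q\<^sup>2 - t) * ((q ^ 3 * P ^ 3 * R ^ 3 - P ^ 3 * t * V) / (q ^ 3 - t) -
      (q * P * R\<^sup>2 * U - t * P * R * U * V) / (q - t))"
    unfolding sum_column[OF assms(1-5) c(1)] P_def R_def U_def V_def
    by (simp add: assms(1,2) power_int_add power_int_diff power_int_numeral_mult distrib_left)
      (simp add: power2_eq_square mult_ac)
  moreover have "even_chains q t (b + c) c =
    (q ^ 3 * P * R\<^sup>2 * U + t ^ 3 * P * U * V\<^sup>2) / ((q - t) * (q\<^sup>2 - t\<^sup>2)) -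
      (q * t * P * R * U * V) / (q - t)\<^sup>2"
    unfolding even_chains_closed[OF assms(1-3,6) c(2)] P_def R_def U_def V_def
    by (simp add: assms(1,2) power_int_add power_int_diff power_int_numeral_mult)
      (simp add: power2_eq_square mult_ac)
  ultimately show ?thesis
    unfolding C
    by (simp only: diff_divide_distrib add_divide_distrib) (simp add: algebra_simps power2_eq_square power3_eq_cube)
qed

lemma F_closed: "F [a, b, c] = Q powi a * half_sum Q T b c + T powi a * half_sum T Q b c"
proof -
  note w = weight4_q_q2_q3 weight4_q_q2_t weight4_q_t_q2 weight4_q_t_qt weight4_q_t_t2
  note wQ = w[OF indep_QT]
  \<comment> \<open>The same weight lemmas at \<open>(T, Q)\<close> give the transposed
    tableaux.\<close>
  note wT = w[OF indep_commute[OF indep_QT], unfolded weight4_commute[of T Q] mon_commute[of T Q]]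
  have "F [a, b, c] =
     mon Q T 1 0 powi a * mon Q T 2 0 powi b * mon Q T 3 0 powi c *
       weight4 Q T (mon Q T 0 0) (mon Q T 1 0) (mon Q T 2 0) (mon Q T 3 0) +
     mon Q T 1 0 powi a * mon Q T 2 0 powi b * mon Q T 0 1 powi c *
       weight4 Q T (mon Q T 0 0) (mon Q T 1 0) (mon Q T 2 0) (mon Q T 0 1) +
     mon Q T 1 0 powi a * mon Q T 0 1 powi b * mon Q T 2 0 powi c *
       weight4 Q T (mon Q T 0 0) (mon Q T 1 0) (mon Q T 0 1) (mon Q T 2 0) +
     mon Q T 1 0 powi a * mon Q T 0 1 powi b * mon Q T 1 1 powi c *
       weight4 Q T (mon Q T 0 0) (mon Q T 1 0) (mon Q T 0 1) (mon Q T 1 1) +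
     mon Q T 1 0 powi a * mon Q T 0 1 powi b * mon Q T 0 2 powi c *
       weight4 Q T (mon Q T 0 0) (mon Q T 1 0) (mon Q T 0 1) (mon Q T 0 2) +
     (mon Q T 0 1 powi a * mon Q T 0 2 powi b * mon Q T 0 3 powi c *
       weight4 Q T (mon Q T 0 0) (mon Q T 0 1) (mon Q T 0 2) (mon Q T 0 3) +
     mon Q T 0 1 powi a * mon Q T 0 2 powi b * mon Q T 1 0 powi c *
       weight4 Q T (mon Q T 0 0) (mon Q T 0 1) (mon Q T 0 2) (mon Q T 1 0) +
     mon Q T 0 1 powi a * mon Q T 1 0 powi b * mon Q T 0 2 powi c *
       weight4 Q T (mon Q T 0 0) (mon Q T 0 1) (mon Q T 1 0) (mon Q T 0 2) +
     mon Q T 0 1 powi a * mon Q T 1 0 powi b * mon Q T 1 1 powi c *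
       weight4 Q T (mon Q T 0 0) (mon Q T 0 1) (mon Q T 1 0) (mon Q T 1 1) +
     mon Q T 0 1 powi a * mon Q T 1 0 powi b * mon Q T 2 0 powi c *
       weight4 Q T (mon Q T 0 0) (mon Q T 0 1) (mon Q T 1 0) (mon Q T 2 0))"
    unfolding F_4_sum shapes_with_boxes_def
    by (simp add: tableau_term_def box_weight_def)
  also have "\<dots> = Q powi a * half_sum Q T b c + T powi a * half_sum T Q b c"
    unfolding wQ wT half_sum_def
    by (simp only: mon_def power_0 power_one_right mult_1_left mult_1_right mult.assoc distrib_left
      mult.commute[of T Q])
  finally show ?thesis .
qed

section \<open>The sum of chains\<close>

text \<open>With \<open>closed_chain\<close>, shift and recurrence hold for all endpoints, without
  conditions on their order.\<close>

definition chain_sum :: "'a \<Rightarrow> 'a \<Rightarrow> int \<Rightarrow> int \<Rightarrow> int \<Rightarrow> 'a :: field" where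
  "chain_sum q t a b c =
    (\<Sum>(i, j) \<in> Qtilde a b c. closed_chain q t (i + eps b c i j) (a + 2 * b + 3 * c - 2 * i - j))"

text \<open>The chain sum satisfies the second-order recurrence of \<open>F\<close> in \<open>a\<close> from \<open>a = b - 1\<close> on,
  except that for \<open>b = c - 1\<close> its value at \<open>a = b - 1\<close> has to be corrected by this term. That
  value lies outside the range of the theorem because \<open>a + 1 < c\<close> there.\<close>

definition correction :: "'a \<Rightarrow> 'a \<Rightarrow> int \<Rightarrow> int \<Rightarrow> int \<Rightarrow> 'a :: field" where
  "correction q t a b c =
    (if b = c - 1 \<and> a = c - 2 then - closed_chain q t (c - 1) (3 * c - 2) else 0)"

section \<open>Layers of the region and the recurrence in \<open>a\<close>\<close>

lemma finite_Qtilde: "finite (Qtilde a b c)"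
proof (rule finite_subset)
  show "Qtilde a b c \<subseteq> {0..b + c} \<times> {0..c}"
    by (auto simp: Qtilde_def)
qed auto

text \<open>The points that enter the region when the parameter goes from \<open>a - 1\<close> to
  \<open>a\<close>.\<close>

definition layer :: "int \<Rightarrow> int \<Rightarrow> int \<Rightarrow> (int \<times> int) set" where
  "layer a b c = {(i, j). 0 \<le> j \<and> j \<le> c \<and> j \<le> i \<and> i \<le> b + c \<and>
     2 * i + 2 * j = a + b + 2 * c - (c - j) mod 2}"

lemma Qtilde_plus_1: "Qtilde (a + 1) b c = Qtilde a b c \<union> layer (a + 1) b c"
  by (auto simp: Qtilde_def layer_def)

lemma Qtilde_layer_disjoint: "Qtilde a b c \<inter> layer (a + 1) b c = {}"
  by (auto simp: Qtilde_def layer_def)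

lemma finite_layer: "finite (layer a b c)"
  by (rule finite_subset[OF _ finite_Qtilde[of a b c]]) (auto simp: Qtilde_def layer_def)

text \<open>As \<open>2 * i + 2 * j\<close> is even, the parity term must have the parity of
  \<open>a + b\<close>, which fixes the parity of \<open>c - j\<close>.\<close>

lemma in_layer_even:
  assumes "even (a + b)"
  shows "(i, j) \<in> layer a b c \<longleftrightarrow> 0 \<le> j \<and> j \<le> c \<and> j \<le> i \<and> i \<le> b + c \<and>
    2 * i + 2 * j = a + b + 2 * c \<and> even (c - j)"
proof (cases "even (c - j)")
  case True
  then have "(c - j) mod 2 = 0"
    by presburger
  then show ?thesis
    using True by (simp add: layer_def)
next
  case False
  then have m: "(c - j) mod 2 = 1"
    by presburger
  have "2 * k \<noteq> s - 1" if "even s" for k s :: int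
    using that by presburger
  from this[of "a + b + 2 * c" "i + j"] show ?thesis
    using False assms by (simp add: layer_def m)
qed

lemma in_layer_odd:
  assumes "odd (a + b)"
  shows "(i, j) \<in> layer a b c \<longleftrightarrow> 0 \<le> j \<and> j \<le> c - 1 \<and> j \<le> i \<and> i \<le> b + c \<and>
    2 * i + 2 * j = a + b + 2 * c - 1 \<and> odd (c - j)"
proof (cases "even (c - j)")
  case True
  then have m: "(c - j) mod 2 = 0"
    by presburger
  have "2 * k \<noteq> s" if "odd s" for k s :: int
    using that by presburger
  from this[of "a + b + 2 * c" "i + j"] show ?thesis
    using True assms by (simp add: layer_def m)
next
  case False
  then have m: "(c - j) mod 2 = 1"
    by presburger
  have "j \<noteq> c"
    using False by auto
  then show ?thesis
    using False by (auto simp: layer_def m)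
qed

text \<open>Raising \<open>j\<close> by 1 maps the first layer onto the second. There
  \<open>i + j >= b + c\<close>, so \<open>eps\<close> grows by 1 too; both ends of the chain move
  up by 1, which gives the factor \<open>q * t\<close>.\<close>

lemma layer_sums_even:
  fixes q t :: "'a :: field"
  assumes "q \<noteq> 0" "t \<noteq> 0" "b \<ge> 0" "c \<ge> 0" "b + 1 \<ge> c" "a + 1 \<ge> b" "even (a + b)"
  shows "(\<Sum>(i, j) \<in> layer (a + 1) b c. q * t * closed_chain q t (i + eps b c i j) (a + 2 * b + 3 * c - 2 * i - j)) =
    (\<Sum>(i, j) \<in> layer (a + 2) b c. closed_chain q t (i + eps b c i j) (a + 2 + 2 * b + 3 * c - 2 * i - j))"
proof -
  \<comment> \<open>Parity excludes \<open>a = b - 1\<close>. The stronger bound ensures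
    \<open>j + 1 <= i\<close> and the growth of \<open>eps\<close>.\<close>
  have ab: "a \<ge> b"
    using assms(6,7) by (cases "a = b - 1") auto
  have odd: "odd (a + 1 + b)" and even: "even (a + 2 + b)"
    using assms(7) by simp_all
  note X = in_layer_odd[OF odd] and Y = in_layer_even[OF even]
  show ?thesis
  proof (rule sum.reindex_bij_witness[where i = "\<lambda>(i, j). (i, j - 1)" and j = "\<lambda>(i, j). (i, j + 1)"]; clarify)
    fix i j assume x: "(i, j) \<in> layer (a + 1) b c"
    then show "(i, j + 1) \<in> layer (a + 2) b c"
      using assms ab unfolding X Y by auto
    have "eps b c i (j + 1) = eps b c i j + 1"
      using x ab unfolding X eps_def by auto
    moreover have "a + 2 + 2 * b + 3 * c - 2 * i - (j + 1) = a + 2 * b + 3 * c - 2 * i - j + 1"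
      by simp
    ultimately show "closed_chain q t (i + eps b c i (j + 1)) (a + 2 + 2 * b + 3 * c - 2 * i - (j + 1)) =
        q * t * closed_chain q t (i + eps b c i j) (a + 2 * b + 3 * c - 2 * i - j)"
      by (simp only: closed_chain_shift[OF assms(1,2), symmetric] add.assoc)
  next
    fix i j assume "(i, j) \<in> layer (a + 2) b c"
    \<comment> \<open>Here \<open>j = 0\<close> is impossible, since it would force
      \<open>i > b + c\<close>.\<close>
    then show "(i, j - 1) \<in> layer (a + 1) b c"
      using assms ab unfolding X Y by (cases "j = 0") auto
  qed auto
qed

text \<open>Both layers lie on the same line of constant \<open>i + j\<close>, with opposite
  parities of \<open>c - j\<close>, so they are matched along this line; \<open>eps\<close> does not
  change.\<close>

lemma layer_sums_odd:
  fixes q t :: "'a :: field"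
  assumes "q \<noteq> 0" "t \<noteq> 0" "b \<ge> 0" "c \<ge> 0" "b + 1 \<ge> c" "a + 1 \<ge> b" "odd (a + b)"
  shows "(\<Sum>(i, j) \<in> layer (a + 1) b c. q * t * closed_chain q t (i + eps b c i j) (a + 2 * b + 3 * c - 2 * i - j)) =
    (\<Sum>(i, j) \<in> layer (a + 2) b c. closed_chain q t (i + eps b c i j) (a + 2 + 2 * b + 3 * c - 2 * i - j)) +
    q * t * correction q t a b c"
    (is "sum ?g ?X = sum ?h ?Y + _")
proof -
  have even: "even (a + 1 + b)" and odd: "odd (a + 2 + b)"
    using assms(7) by simp_all
  note X = in_layer_even[OF even] and Y = in_layer_odd[OF odd]
  \<comment> \<open>The only point of the second layer without a preimage: \<open>(c - 1, c)\<close>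
    violates \<open>j <= i\<close>.\<close>
  define E where "E = (if b = c - 1 \<and> a = c - 2 then {(c, c - 1)} else {})"
  have eq: "?h (i + 1, j - 1) = ?g (i, j)" for i j
  proof -
    have "i + 1 + eps b c (i + 1) (j - 1) = i + eps b c i j + 1"
      "a + 2 + 2 * b + 3 * c - 2 * (i + 1) - (j - 1) = a + 2 * b + 3 * c - 2 * i - j + 1"
      by (simp_all add: eps_def)
    then show ?thesis
      by (simp only: prod.case closed_chain_shift[OF assms(1,2)])
  qed
  have "sum ?g ?X = sum ?h (?Y - E)"
  proof (rule sum.reindex_bij_witness_not_neutral[where S' = "{(i, j) \<in> ?X. i = b + c}" and T' = "{}"
        and i = "\<lambda>(i, j). (i - 1, j + 1)" and j = "\<lambda>(i, j). (i + 1, j - 1)"])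
    show "finite {(i, j) \<in> ?X. i = b + c}"
      by (rule finite_subset[OF _ finite_layer]) auto
    show "finite {}" ..
  next
    fix p assume p: "p \<in> ?X - {(i, j) \<in> ?X. i = b + c}"
    show "(case case p of (i, j) \<Rightarrow> (i + 1, j - 1) of (i, j) \<Rightarrow> (i - 1, j + 1)) = p"
      by (simp add: case_prod_beta)
    show "(case p of (i, j) \<Rightarrow> (i + 1, j - 1)) \<in> ?Y - E - {}"
      using p assms by (cases p) (auto simp: X Y E_def)
  next
    fix p assume p: "p \<in> ?Y - E - {}"
    obtain i j where ij: "p = (i, j)"
      by force
    show "(case case p of (i, j) \<Rightarrow> (i - 1, j + 1) of (i, j) \<Rightarrow> (i + 1, j - 1)) = p"
      by (simp add: case_prod_beta)
    have "i \<ge> j + 2"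
      using p assms unfolding ij E_def by (auto simp: Y split: if_splits)
    then show "(case p of (i, j) \<Rightarrow> (i - 1, j + 1)) \<in> ?X - {(i, j) \<in> ?X. i = b + c}"
      using p assms unfolding ij by (auto simp: X Y)
  next
    \<comment> \<open>Points with \<open>i = b + c\<close> cannot move, but their upper end is one
      below the lower end, so the chain vanishes.\<close>
    fix p assume "p \<in> {(i, j) \<in> ?X. i = b + c}"
    then obtain j where p: "p = (b + c, j)" and j: "(b + c, j) \<in> ?X"
      by auto
    then have l: "a + 2 * b + 3 * c - 2 * (b + c) - j = b + c + eps b c (b + c) j - 1"
      using assms unfolding X eps_def by auto
    show "?g p = 0"
      unfolding p prod.case l by simp
  next
    fix p
    show "?h (case p of (i, j) \<Rightarrow> (i + 1, j - 1)) = ?g p"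
      by (cases p) (use eq in simp)
  qed simp
  also have "\<dots> = sum ?h ?Y + q * t * correction q t a b c"
  proof (cases "b = c - 1 \<and> a = c - 2")
    case True
    have "(c, c - 1) \<in> ?Y"
      unfolding Y using True assms by auto
    then have "sum ?h (?Y - E) = sum ?h ?Y - ?h (c, c - 1)"
      using True by (simp add: E_def sum_diff1 finite_layer)
    also have "?h (c, c - 1) = closed_chain q t (c - 1 + 1) (3 * c - 2 + 1)"
      using True by (simp add: eps_def)
    also have "\<dots> = q * t * closed_chain q t (c - 1) (3 * c - 2)"
      by (rule closed_chain_shift[OF assms(1,2)])
    finally show ?thesis
      using True by (simp add: correction_def)
  next
    case False
    then show ?thesis
      by (auto simp: E_def correction_def)
  qed
  finally show ?thesis .
qed

text \<open>Each single chain satisfies the recurrence. Summing over the region at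
  \<open>a + 1\<close> omits the layer \<open>a + 2\<close> and includes the layer
  \<open>a + 1\<close> in the sum for \<open>a\<close>; by the layer lemmas these cancel up to
  \<open>correction\<close>.\<close>

lemma chain_sum_recurrence:
  fixes q t :: "'a :: field"
  assumes "q \<noteq> 0" "t \<noteq> 0" "b \<ge> 0" "c \<ge> 0" "b + 1 \<ge> c" "a + 1 \<ge> b"
  shows "chain_sum q t (a + 2) b c = (q + t) * chain_sum q t (a + 1) b c -
    q * t * (chain_sum q t a b c + correction q t a b c)"
proof -
  define f where "f n = (\<lambda>(i, j). closed_chain q t (i + eps b c i j) (n + 2 * b + 3 * c - 2 * i - j))" for n
  have rec: "f (a + 2) p = (q + t) * f (a + 1) p - q * t * f a p" for p
    using closed_chain_recurrence[OF assms(1,2), of "fst p + eps b c (fst p) (snd p)"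
        "a + 2 * b + 3 * c - 2 * fst p - snd p"]
    by (simp add: f_def case_prod_beta algebra_simps)
  have layers: "q * t * sum (f a) (layer (a + 1) b c) =
      sum (f (a + 2)) (layer (a + 2) b c) + q * t * correction q t a b c"
  proof (cases "even (a + b)")
    case True
    then have "correction q t a b c = 0"
      by (auto simp: correction_def)
    then show ?thesis
      using layer_sums_even[OF assms True] by (simp add: f_def case_prod_beta sum_distrib_left)
  next
    case False
    then show ?thesis
      using layer_sums_odd[OF assms False] by (simp add: f_def case_prod_beta sum_distrib_left)
  qed
  have split: "sum g (Qtilde (n + 1) b c) = sum g (Qtilde n b c) + sum g (layer (n + 1) b c)"
    for g :: "int \<times> int \<Rightarrow> 'a" and n
    unfolding Qtilde_plus_1
    by (rule sum.union_disjoint[OF finite_Qtilde finite_layer Qtilde_layer_disjoint])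
  have chain_sum: "chain_sum q t n b c = sum (f n) (Qtilde n b c)" for n
    by (simp add: chain_sum_def f_def)
  have a2: "a + 1 + 1 = a + 2"
    by simp
  have "chain_sum q t (a + 2) b c = sum (f (a + 2)) (Qtilde (a + 1) b c) + sum (f (a + 2)) (layer (a + 2) b c)"
    unfolding chain_sum a2[symmetric] by (rule split)
  also have "sum (f (a + 2)) (Qtilde (a + 1) b c) =
      (q + t) * chain_sum q t (a + 1) b c - q * t * sum (f a) (Qtilde (a + 1) b c)"
    unfolding chain_sum by (simp add: rec sum_subtractf sum_distrib_left)
  also have "sum (f a) (Qtilde (a + 1) b c) = chain_sum q t a b c + sum (f a) (layer (a + 1) b c)"
    unfolding chain_sum by (rule split)
  finally show ?thesis
    using layers by (simp add: algebra_simps)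
qed

section \<open>Base values at \<open>a = b - 1\<close> and \<open>a = b\<close>\<close>

text \<open>For \<open>j = N - j + 1\<close> the sum over \<open>i = j, \<dots>, N - j - 1\<close> has "length -1", and the
  subtracted summand is what keeps the geometric sum formula valid.\<close>

lemma chain_column:
  fixes q t :: "'a :: field"
  assumes "q \<noteq> 0" "t \<noteq> 0" "q\<^sup>2 \<noteq> t" "t\<^sup>2 \<noteq> q" "j \<le> N - j + 1"
  shows "(\<Sum>i = j..N - j - 1. closed_chain q t i (3 * N - 1 + d - 2 * i - j)) -
      (if j = N - j + 1 then closed_chain q t (N - j) (N + j - 1 + d) else 0) =
    (q powi d * column q t N j - t powi d * column t q N j) / (q - t)"
proof -
  let ?g = "\<lambda>x y i. x powi (3 * N - j - 2 * i) * y powi i"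
  have cc: "closed_chain q t i (3 * N - 1 + d - 2 * i - j) =
      (q powi d * ?g q t i - t powi d * ?g t q i) / (q - t)" for i
  proof -
    have *: "3 * N - 1 + d - 2 * i - j + 1 = d + (3 * N - j - 2 * i)"
      by simp
    show ?thesis
      unfolding closed_chain_def * using assms(1,2) by (simp add: power_int_add mult_ac)
  qed
  have col: "column x y N j = (\<Sum>i = j..N - j - 1. ?g x y i) - (if j = N - j + 1 then ?g x y (N - j) else 0)"
    if "x \<noteq> 0" "y \<noteq> 0" "x\<^sup>2 \<noteq> y" for x y :: 'a
    unfolding geometric_column[OF that assms(5)] column_def
    by (simp add: algebra_simps)
  have last: "closed_chain q t (N - j) (N + j - 1 + d) =
      (q powi d * ?g q t (N - j) - t powi d * ?g t q (N - j)) / (q - t)"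
    using cc[of "N - j"] by (simp add: algebra_simps)
  have "(\<Sum>i = j..N - j - 1. closed_chain q t i (3 * N - 1 + d - 2 * i - j)) =
      (q powi d * (\<Sum>i = j..N - j - 1. ?g q t i) - t powi d * (\<Sum>i = j..N - j - 1. ?g t q i)) / (q - t)"
    unfolding cc by (simp only: sum_divide_distrib[symmetric] sum_subtractf sum_distrib_left)
  then show ?thesis
    unfolding last col[OF assms(1,2,3)] col[OF assms(2,1,4)]
    by (simp add: right_diff_distrib diff_divide_distrib)
qed

text \<open>The triangle is summed column by column. The two base values use \<open>d = 0\<close>
  and \<open>d = 1\<close>, where \<open>a = b - 1 + d\<close>.\<close>

lemma sum_chain_triangle:
  fixes q t :: "'a :: field"
  assumes "q \<noteq> 0" "t \<noteq> 0" "q\<^sup>2 \<noteq> t" "t\<^sup>2 \<noteq> q" "c \<ge> 0" "b + 1 \<ge> c"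
  shows "(\<Sum>(i, j) \<in> {(i, j). 0 \<le> j \<and> j \<le> c \<and> j \<le> i \<and> i + j \<le> b + c - 1}.
      closed_chain q t i (3 * (b + c) - 1 + d - 2 * i - j)) -
      (if b = c - 1 then closed_chain q t (c - 1) (3 * c - 2 + d) else 0) =
    (q powi d * (\<Sum>j = 0..c. column q t (b + c) j) - t powi d * (\<Sum>j = 0..c. column t q (b + c) j)) / (q - t)"
    (is "sum ?f ?A - _ = _")
proof -
  let ?N = "b + c"
  have "sum ?f ?A = (\<Sum>(j, i) \<in> (SIGMA j : {0..c}. {j..?N - j - 1}). ?f (i, j))"
    by (rule sum.reindex_bij_witness[where i = prod.swap and j = prod.swap]) auto
  also have "\<dots> = (\<Sum>j = 0..c. \<Sum>i = j..?N - j - 1. ?f (i, j))"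
    by (rule sum.Sigma[symmetric]) auto
  finally have 1: "sum ?f ?A = \<dots>" .
  \<comment> \<open>Since \<open>j <= c <= b + 1\<close>, the equation
    \<open>2 * j = b + c + 1\<close> forces \<open>j = c\<close> and
    \<open>b = c - 1\<close>.\<close>
  have "(\<Sum>j = 0..c. if j = ?N - j + 1 then closed_chain q t (?N - j) (?N + j - 1 + d) else 0) =
      (\<Sum>j = 0..c. if j = c then (if b = c - 1 then closed_chain q t (c - 1) (3 * c - 2 + d) else 0) else 0)"
    using assms(6) by (intro sum.cong refl) auto
  also have "\<dots> = (if b = c - 1 then closed_chain q t (c - 1) (3 * c - 2 + d) else 0)"
    using assms(5) by simp
  finally have 2: "(if b = c - 1 then closed_chain q t (c - 1) (3 * c - 2 + d) else 0) =
      (\<Sum>j = 0..c. if j = ?N - j + 1 then closed_chain q t (?N - j) (?N + j - 1 + d) else 0)" ..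
  have "sum ?f ?A - (if b = c - 1 then closed_chain q t (c - 1) (3 * c - 2 + d) else 0) =
      (\<Sum>j = 0..c. (q powi d * column q t ?N j - t powi d * column t q ?N j) / (q - t))"
    unfolding 1 2 sum_subtractf[symmetric] prod.case
    by (intro sum.cong refl chain_column[OF assms(1-4)]) (use assms(6) in auto)
  also have "\<dots> = (q powi d * (\<Sum>j = 0..c. column q t ?N j) - t powi d * (\<Sum>j = 0..c. column t q ?N j)) / (q - t)"
    by (simp only: sum_divide_distrib[symmetric] sum_subtractf sum_distrib_left)
  finally show ?thesis .
qed

lemma chain_sum_base_0:
  fixes q t :: "'a :: field"
  assumes "q \<noteq> 0" "t \<noteq> 0" "q\<^sup>2 \<noteq> t" "t\<^sup>2 \<noteq> q" "b \<ge> 0" "c \<ge> 0" "b + 1 \<ge> c"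
  shows "chain_sum q t (b - 1) b c + correction q t (b - 1) b c =
    ((\<Sum>j = 0..c. column q t (b + c) j) - (\<Sum>j = 0..c. column t q (b + c) j)) / (q - t)"
proof -
  \<comment> \<open>The bound on \<open>2 * i + 2 * j\<close> is \<open>2 * (b + c) - 1\<close> or
    one less; both mean \<open>i + j <= b + c - 1\<close>.\<close>
  have "Qtilde (b - 1) b c = {(i, j). 0 \<le> j \<and> j \<le> c \<and> j \<le> i \<and> i + j \<le> b + c - 1}" (is "_ = ?A")
  proof -
    have "0 \<le> j \<and> j \<le> c \<and> j \<le> i \<and> i \<le> b + c \<and> 2 * i + 2 * j \<le> b - 1 + b + 2 * c - (c - j) mod 2 \<longleftrightarrow>
        0 \<le> j \<and> j \<le> c \<and> j \<le> i \<and> i + j \<le> b + c - 1" for i j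
      by presburger
    then show ?thesis
      by (auto simp: Qtilde_def)
  qed
  then have chain_sum: "chain_sum q t (b - 1) b c = (\<Sum>(i, j) \<in> ?A. closed_chain q t i (3 * (b + c) - 1 + 0 - 2 * i - j))"
    unfolding chain_sum_def by (intro sum.cong) (auto simp: eps_def algebra_simps)
  have correction: "correction q t (b - 1) b c =
      - (if b = c - 1 then closed_chain q t (c - 1) (3 * c - 2 + 0) else 0)"
    by (simp add: correction_def)
  show ?thesis
    unfolding chain_sum correction using sum_chain_triangle[OF assms(1-4,6,7), of 0]
    by (simp only: power_int_0_right mult_1_left add_uminus_conv_diff)
qed

text \<open>The region is the previous triangle together with a layer on the line
  \<open>i + j = b + c\<close>.\<close>

lemma chain_sum_base_1:
  fixes q t :: "'a :: field"
  assumes "q \<noteq> 0" "t \<noteq> 0" "q\<^sup>2 \<noteq> t" "t\<^sup>2 \<noteq> q" "b \<ge> 0" "c \<ge> 0" "b + 1 \<ge> c"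
  shows "chain_sum q t b b c =
    (q * (\<Sum>j = 0..c. column q t (b + c) j) - t * (\<Sum>j = 0..c. column t q (b + c) j)) / (q - t) +
    even_chains q t (b + c) c"
proof -
  let ?A = "{(i, j). 0 \<le> j \<and> j \<le> c \<and> j \<le> i \<and> i + j \<le> b + c - 1}"
  let ?L = "layer b b c"
  let ?f = "\<lambda>(i, j). closed_chain q t (i + eps b c i j) (b + 2 * b + 3 * c - 2 * i - j)"
  let ?J = "{j. 0 \<le> j \<and> j \<le> c \<and> even (c - j)}"
  have e: "even (b + b)"
    by simp
  note L = in_layer_even[OF e]
  have "0 \<le> j \<and> j \<le> c \<and> j \<le> i \<and> i \<le> b + c \<and> 2 * i + 2 * j \<le> b - 1 + b + 2 * c - (c - j) mod 2 \<longleftrightarrow>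
        0 \<le> j \<and> j \<le> c \<and> j \<le> i \<and> i + j \<le> b + c - 1" for i j
    by presburger
  then have A: "Qtilde (b - 1) b c = ?A"
    by (auto simp: Qtilde_def)
  have "chain_sum q t b b c = sum ?f ?A + sum ?f ?L"
    unfolding chain_sum_def
    using Qtilde_plus_1[of "b - 1" b c] Qtilde_layer_disjoint[of "b - 1" b c] finite_Qtilde[of "b - 1" b c]
      finite_layer[of b b c]
    by (simp add: A sum.union_disjoint)
  also have "sum ?f ?A = (\<Sum>(i, j) \<in> ?A. closed_chain q t i (3 * (b + c) - 1 + 1 - 2 * i - j))"
    by (intro sum.cong) (auto simp: eps_def algebra_simps)
  \<comment> \<open>For \<open>b = c - 1\<close> the layer lacks the term \<open>j = c\<close> of
    \<open>even_chains\<close>; it cancels against the extra term of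
    \<open>sum_chain_triangle\<close>.\<close>
  also have "sum ?f ?L = even_chains q t (b + c) c - (if b = c - 1 then closed_chain q t (c - 1) (3 * c - 2 + 1) else 0)"
  proof -
    have "sum ?f ?L = (\<Sum>j \<in> {j \<in> ?J. 2 * j \<le> b + c}. closed_chain q t (b + c - j) (b + c + j))"
    proof (rule sum.reindex_bij_witness[where i = "\<lambda>j. (b + c - j, j)" and j = snd]; clarsimp simp: L)
      fix i j assume ij: "2 * i + 2 * j = 2 * b + 2 * c"
      then have "i = b + c - j"
        by simp
      then show "closed_chain q t (b + c - j) (b + c + j) =
          closed_chain q t (i + eps b c i j) (3 * b + 3 * c - 2 * i - j)"
        by (simp add: eps_def add_ac)
    qed
    moreover have "?J = {j \<in> ?J. 2 * j \<le> b + c} \<union> (if b = c - 1 then {c} else {})"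
      using assms(6,7) by auto
    then have "even_chains q t (b + c) c =
        (\<Sum>j \<in> {j \<in> ?J. 2 * j \<le> b + c} \<union> (if b = c - 1 then {c} else {}). closed_chain q t (b + c - j) (b + c + j))"
      unfolding even_chains_def by (rule sum.cong[OF _ refl])
    moreover have "finite {j \<in> ?J. 2 * j \<le> b + c}"
      by (rule finite_subset[of _ "{0..c}"]) auto
    ultimately show ?thesis
      by (auto simp: sum.union_disjoint algebra_simps)
  qed
  finally show ?thesis
    using sum_chain_triangle[OF assms(1-4,6,7), of 1] by (simp only: power_int_1_right) (simp add: algebra_simps)
qed

text \<open>Both sides obey the same second-order recurrence in \<open>a\<close>, so two consecutive
  base values decide.\<close>

lemma half_sums_eq_chain_sum:
  fixes q t :: "'a :: field"
  assumes nz: "q \<noteq> 0" "t \<noteq> 0" and ne: "q \<noteq> t" "q\<^sup>2 \<noteq> t" "t\<^sup>2 \<noteq> q" "q ^ 3 \<noteq> t" "t ^ 3 \<noteq> q" "q\<^sup>2 \<noteq> t\<^sup>2"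
    and bc: "b \<ge> 0" "c \<ge> 0" "b + 1 \<ge> c" and a: "a + 1 \<ge> b"
  shows "q powi a * half_sum q t b c + t powi a * half_sum t q b c =
    chain_sum q t a b c + correction q t a b c"
proof -
  define G where "G n = q powi n * half_sum q t b c + t powi n * half_sum t q b c" for n
  define R where "R n = chain_sum q t n b c + correction q t n b c" for n
  let ?u = "\<Sum>j = 0..c. column q t (b + c) j" and ?u' = "\<Sum>j = 0..c. column t q (b + c) j"
  let ?V = "even_chains q t (b + c) c"
  have h: "q powi (b - 1) * half_sum q t b c = (?u + ?V) / (q - t)"
    using half_sum_eq[OF nz ne(1,2,4,6) bc(2), of b] ne(1) by (simp add: field_simps)
  have V: "even_chains t q (b + c) c = ?V"
    by (simp add: even_chains_def closed_chain_commute)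
  have "(t - q) * (t powi (b - 1) * half_sum t q b c) = ?u' + ?V"
    using half_sum_eq[OF nz(2,1) ne(1)[symmetric] ne(3,5) ne(6)[symmetric] bc(2), of b] V by simp
  then have h': "t powi (b - 1) * half_sum t q b c = - ((?u' + ?V) / (q - t))"
    using ne(1) by (simp add: field_simps)
  \<comment> \<open>\<open>?V\<close> is symmetric in \<open>q\<close> and \<open>t\<close> and
    occurs with opposite signs in \<open>h\<close> and \<open>h'\<close>, so it cancels here; in
    \<open>G b\<close> it survives with weight \<open>q - t\<close>.\<close>
  have G0: "G (b - 1) = R (b - 1)"
    unfolding G_def R_def h h' chain_sum_base_0[OF nz ne(2,3) bc] by (simp add: diff_divide_distrib add_divide_distrib)
  have "q powi b = q * q powi (b - 1)" "t powi b = t * t powi (b - 1)"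
    using nz by (simp_all add: power_int_diff)
  then have "G b = q * ((?u + ?V) / (q - t)) - t * ((?u' + ?V) / (q - t))"
    unfolding G_def by (simp only: mult.assoc h h') simp
  also have "\<dots> = (q * (?u + ?V) - t * (?u' + ?V)) / (q - t)"
    by (simp add: diff_divide_distrib)
  also have "q * (?u + ?V) - t * (?u' + ?V) = (q * ?u - t * ?u') + (q - t) * ?V"
    by (simp add: algebra_simps)
  also have "\<dots> / (q - t) = R b"
    using ne(1) by (auto simp: R_def chain_sum_base_1[OF nz ne(2,3) bc] correction_def add_divide_distrib)
  finally have G1: "G b = R b" .
  have "G n = R n \<and> G (n + 1) = R (n + 1)" if "n \<ge> b - 1" for n
    using that
  proof (induction n rule: int_ge_induct)
    case base
    then show ?case
      using G0 G1 by simp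
  next
    case (step n)
    \<comment> \<open>The correction can be nonzero only at \<open>b - 1\<close>, the first value of
      \<open>n\<close>, where \<open>R\<close> contains it.\<close>
    have c0: "correction q t (n + 1) b c = 0" "correction q t (n + 2) b c = 0"
      using step(1) by (auto simp: correction_def)
    have "G (n + 2) = (q + t) * G (n + 1) - q * t * G n"
      using nz by (simp add: G_def power_int_add power2_eq_square algebra_simps)
    also have "\<dots> = R (n + 2)"
      using chain_sum_recurrence[OF nz bc, of n] step c0 by (simp add: R_def)
    finally show ?case
      using step by (simp add: add.assoc)
  qed
  then show ?thesis
    using a by (simp add: G_def R_def)
qed

theorem theorem3p1:
  fixes a b c A :: int
  assumes "a \<ge> 0" and "b \<ge> 0" and "c \<ge> 0"
    and "a + 1 \<ge> b" and "a + 1 \<ge> c" and "b + 1 \<ge> c"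
    and "A = a + 2 * b + 3 * c"
  shows "F [a, b, c] = (\<Sum>(i, j) \<in> Qtilde a b c. chain (i + eps b c i j) (A - 2 * i - j))"
proof -
  note QT = indep_distinct[OF indep_QT]
  have "F [a, b, c] = chain_sum Q T a b c + correction Q T a b c"
    unfolding F_closed
    by (rule half_sums_eq_chain_sum) (use QT QT(7,8)[symmetric] assms in auto)
  \<comment> \<open>A nonzero correction would need \<open>a = c - 2\<close>, against
    \<open>a + 1 >= c\<close>.\<close>
  also have "correction Q T a b c = 0"
    using assms by (auto simp: correction_def)
  also have "chain_sum Q T a b c + 0 = (\<Sum>(i, j) \<in> Qtilde a b c. chain (i + eps b c i j) (A - 2 * i - j))"
    unfolding chain_sum_def add_0_right
  proof (intro sum.cong refl, clarify)
    fix i j assume "(i, j) \<in> Qtilde a b c"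
    moreover have "(c - j) mod 2 \<ge> 0"
      by simp
    \<comment> \<open>Allowing an empty chain is enough for \<open>sum_chain_closed\<close>, hence
      the \<open>+ 1\<close>.\<close>
    ultimately have "i + eps b c i j \<le> A - 2 * i - j + 1"
      using assms unfolding Qtilde_def eps_def mem_Collect_eq prod.case max_def by (simp; linarith)
    then show "closed_chain Q T (i + eps b c i j) (a + 2 * b + 3 * c - 2 * i - j) =
        chain (i + eps b c i j) (A - 2 * i - j)"
      unfolding chain_def assms(7)[symmetric] by (rule sum_chain_closed[OF QT(1-3), symmetric])
  qed
  finally show ?thesis .
qed
end
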